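(* Let $\pi$ be a unitary representation of a discrete group $\Gamma$. A normal subgroup $\Lambda\trianglelefteq\Gamma$ is $\pi$-amenable if and only if $\Lambda$ acts trivially on $\mathcal{B}_\pi$.
   Context: For a unitary representation $\pi:\Gamma\to\mathcal{U}(\mathcal{H}_\pi)$, $\Gamma$ acts on $B(\mathcal{H}_\pi)$ by $g\cdot x=\pi(g)x\pi(g^{-1})$. A $\Gamma$-map between operator systems carrying $\Gamma$-actions is a unital completely positive $\Gamma$-equivariant linear map. If $\Lambda\trianglelefteq\Gamma$ is normal, the commutant $\pi(\Lambda)'\subseteq B(\mathcal{H}_\pi)$ is $\Gamma$-invariant; $\Lambda$ is called $\pi$-amenable if there is a $\Gamma$-map $B(\mathcal{H}_\pi)\to\pi(\Lambda)'$. Furstenberg--Hamana (FH) boundary: on the set $\mathcal{G}$ of all $\Gamma$-maps $\phi:B(\mathcal{H}_\pi)\to B(\mathcal{H}_\pi)$ put the preorder $\phi\le\psi$ iff $\|\phi(x)\|\le\|\psi(x)\|$ for all $x$. Then $\mathcal{G}$ has minimal elements, every minimal element is idempotent, and its image is unique up to bijective completely isometric $\Gamma$-maps. $\mathcal{B}_\pi$ is the image of a minimal $\phi\in\mathcal{G}$, with the Choi--Effros product $a\cdot b=\phi(ab)$ and the restricted $\Gamma$-action; it is a $\Gamma$-$C^*$-algebra. *)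

theory Defs
  imports "HOL-Analysis.Analysis" "HOL-Algebra.Coset" "HOL-Algebra.Ring"
begin

text \<open>
  The real inner product of \<open>real_inner\<close> is the real part of the complex one, so the norm is
  the usual Hilbert space norm.  The complex inner product is linear in the first argument.
\<close>

class complex_hilbert = real_inner + complete_space +
  fixes scaleC :: "complex \<Rightarrow> 'a \<Rightarrow> 'a" (infixr "*\<^sub>C" 75)
    and cinner :: "'a \<Rightarrow> 'a \<Rightarrow> complex"
  assumes scaleC_add_right: "c *\<^sub>C (x + y) = c *\<^sub>C x + c *\<^sub>C y"
    and scaleC_add_left: "(c + d) *\<^sub>C x = c *\<^sub>C x + d *\<^sub>C x"
    and scaleC_scaleC: "c *\<^sub>C d *\<^sub>C x = (c * d) *\<^sub>C x"
    and scaleC_of_real: "complex_of_real r *\<^sub>C x = r *\<^sub>R x"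
    and cinner_add_left: "cinner (x + y) z = cinner x z + cinner y z"
    and cinner_scaleC_left: "cinner (c *\<^sub>C x) y = c * cinner x y"
    and cinner_commute: "cinner x y = cnj (cinner y x)"
    and Re_cinner: "Re (cinner x y) = inner x y"

instantiation complex :: complex_hilbert
begin

definition scaleC_complex :: "complex \<Rightarrow> complex \<Rightarrow> complex"
  where "scaleC_complex c x = c * x"

definition cinner_complex :: "complex \<Rightarrow> complex \<Rightarrow> complex"
  where "cinner_complex x y = x * cnj y"

instance
  by standard
    (auto simp: scaleC_complex_def cinner_complex_def algebra_simps inner_complex_def
      scaleR_conv_of_real)

end

lemma norm_scaleC: "norm (c *\<^sub>C x) = norm c * norm (x :: 'h::complex_hilbert)"
proof -
  have *: "cinner (c *\<^sub>C x) (c *\<^sub>C x) = complex_of_real ((norm c)\<^sup>2) * cinner x x"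
  proof -
    have "cinner (c *\<^sub>C x) (c *\<^sub>C x) = c * cnj (cinner (c *\<^sub>C x) x)"
      by (metis cinner_scaleC_left cinner_commute)
    also have "\<dots> = c * cnj c * cnj (cinner x x)"
      by (simp add: cinner_scaleC_left)
    also have "cnj (cinner x x) = cinner x x"
      by (metis cinner_commute)
    finally show ?thesis
      by (simp only: complex_norm_square)
  qed
  have "inner (c *\<^sub>C x) (c *\<^sub>C x) = (norm c)\<^sup>2 * inner x x"
    using arg_cong[OF *, of Re] by (simp only: Re_cinner Re_complex_of_real Im_complex_of_real
        times_complex.sel mult_zero_left diff_zero)
  then show ?thesis
    by (simp add: norm_eq_sqrt_inner real_sqrt_mult)
qed


text \<open>
  \<open>'h \<Rightarrow>\<^sub>L 'h\<close> consists of the bounded \<^emph>\<open>real\<close>-linear operators, with the operator norm;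
  \<open>B(H)\<close> is its subset of complex-linear ones.
\<close>

definition bounded_ops :: "('h::complex_hilbert \<Rightarrow>\<^sub>L 'h) set"
  where "bounded_ops = {T. \<forall>c x. blinfun_apply T (c *\<^sub>C x) = c *\<^sub>C blinfun_apply T x}"

lift_definition scaleC_op :: "complex \<Rightarrow> ('h::complex_hilbert \<Rightarrow>\<^sub>L 'h) \<Rightarrow> ('h \<Rightarrow>\<^sub>L 'h)"
  is "\<lambda>c T x. c *\<^sub>C T x"
proof -
  fix c :: complex and T :: "'h \<Rightarrow> 'h"
  assume T: "bounded_linear T"
  have "bounded_linear (\<lambda>y :: 'h. c *\<^sub>C y)"
  proof (rule bounded_linear_intro[where K = "norm c"])
    fix r and y :: 'h
    show "c *\<^sub>C (r *\<^sub>R y) = r *\<^sub>R c *\<^sub>C y"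
      by (simp add: scaleC_scaleC mult.commute flip: scaleC_of_real)
  qed (simp_all add: scaleC_add_right norm_scaleC mult.commute)
  then show "bounded_linear (\<lambda>x. c *\<^sub>C T x)"
    using T bounded_linear_compose by blast
qed

definition unitary_group :: "('h::complex_hilbert \<Rightarrow>\<^sub>L 'h) monoid"
  where "unitary_group =
    \<lparr>carrier = {U \<in> bounded_ops. surj (blinfun_apply U) \<and>
        (\<forall>x y. cinner (blinfun_apply U x) (blinfun_apply U y) = cinner x y)},
     mult = (o\<^sub>L), one = id_blinfun\<rparr>"

definition commutant :: "('h::complex_hilbert \<Rightarrow>\<^sub>L 'h) set \<Rightarrow> ('h \<Rightarrow>\<^sub>L 'h) set"
  where "commutant A = {T \<in> bounded_ops. \<forall>a\<in>A. a o\<^sub>L T = T o\<^sub>L a}"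

text \<open>
  Positivity of the matrix \<open>(X i j)\<close>, \<open>i, j < n\<close>, as an operator on the \<open>n\<close>-fold direct sum
  of the Hilbert space: \<open>\<langle>X \<xi>, \<xi>\<rangle> \<ge> 0\<close> for all vectors \<open>\<xi>\<close>.
\<close>

definition positive_matrix :: "nat \<Rightarrow> (nat \<Rightarrow> nat \<Rightarrow> ('h::complex_hilbert \<Rightarrow>\<^sub>L 'h)) \<Rightarrow> bool"
  where "positive_matrix n X \<longleftrightarrow>
    (\<forall>\<xi> :: nat \<Rightarrow> 'h. (\<Sum>i<n. cinner (\<Sum>j<n. blinfun_apply (X i j) (\<xi> j)) (\<xi> i)) \<in> \<real>\<^sub>\<ge>\<^sub>0)"

definition completely_positive_on ::
    "('h::complex_hilbert \<Rightarrow>\<^sub>L 'h) set \<Rightarrow> (('h \<Rightarrow>\<^sub>L 'h) \<Rightarrow> ('h \<Rightarrow>\<^sub>L 'h)) \<Rightarrow> bool"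
  where "completely_positive_on S \<phi> \<longleftrightarrow>
    (\<forall>n X. (\<forall>i<n. \<forall>j<n. X i j \<in> S) \<longrightarrow> positive_matrix n X \<longrightarrow>
      positive_matrix n (\<lambda>i j. \<phi> (X i j)))"

definition conj_action ::
    "('g, 'b) monoid_scheme \<Rightarrow> ('g \<Rightarrow> ('h::complex_hilbert \<Rightarrow>\<^sub>L 'h)) \<Rightarrow> 'g \<Rightarrow> ('h \<Rightarrow>\<^sub>L 'h) \<Rightarrow> ('h \<Rightarrow>\<^sub>L 'h)"
  where "conj_action \<Gamma> \<pi> g x = \<pi> g o\<^sub>L x o\<^sub>L \<pi> (inv\<^bsub>\<Gamma>\<^esub> g)"

text \<open>
  \<open>S\<close> and \<open>T\<close> are meant to be operator systems in \<open>B(H)\<close> that are invariant under the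
  conjugation action.  The values of \<open>\<phi>\<close> outside \<open>S\<close> are irrelevant.
\<close>

definition gamma_map ::
    "('g, 'b) monoid_scheme \<Rightarrow> ('g \<Rightarrow> ('h::complex_hilbert \<Rightarrow>\<^sub>L 'h)) \<Rightarrow>
      ('h \<Rightarrow>\<^sub>L 'h) set \<Rightarrow> ('h \<Rightarrow>\<^sub>L 'h) set \<Rightarrow> (('h \<Rightarrow>\<^sub>L 'h) \<Rightarrow> ('h \<Rightarrow>\<^sub>L 'h)) \<Rightarrow> bool"
  where "gamma_map \<Gamma> \<pi> S T \<phi> \<longleftrightarrow>
    \<phi> \<in> S \<rightarrow> T \<and>
    (\<forall>x\<in>S. \<forall>y\<in>S. \<phi> (x + y) = \<phi> x + \<phi> y) \<and>
    (\<forall>c. \<forall>x\<in>S. \<phi> (scaleC_op c x) = scaleC_op c (\<phi> x)) \<and>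
    \<phi> id_blinfun = id_blinfun \<and>
    completely_positive_on S \<phi> \<and>
    (\<forall>g\<in>carrier \<Gamma>. \<forall>x\<in>S. \<phi> (conj_action \<Gamma> \<pi> g x) = conj_action \<Gamma> \<pi> g (\<phi> x))"

definition pi_amenable ::
    "('g, 'b) monoid_scheme \<Rightarrow> ('g \<Rightarrow> ('h::complex_hilbert \<Rightarrow>\<^sub>L 'h)) \<Rightarrow> 'g set \<Rightarrow> bool"
  where "pi_amenable \<Gamma> \<pi> \<Lambda> \<longleftrightarrow> (\<exists>\<phi>. gamma_map \<Gamma> \<pi> bounded_ops (commutant (\<pi> ` \<Lambda>)) \<phi>)"

definition fh_maps ::
    "('g, 'b) monoid_scheme \<Rightarrow> ('g \<Rightarrow> ('h::complex_hilbert \<Rightarrow>\<^sub>L 'h)) \<Rightarrow> (('h \<Rightarrow>\<^sub>L 'h) \<Rightarrow> ('h \<Rightarrow>\<^sub>L 'h)) set"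
  where "fh_maps \<Gamma> \<pi> = {\<phi>. gamma_map \<Gamma> \<pi> bounded_ops bounded_ops \<phi>}"

definition fh_le ::
    "(('h::complex_hilbert \<Rightarrow>\<^sub>L 'h) \<Rightarrow> ('h \<Rightarrow>\<^sub>L 'h)) \<Rightarrow> (('h \<Rightarrow>\<^sub>L 'h) \<Rightarrow> ('h \<Rightarrow>\<^sub>L 'h)) \<Rightarrow> bool"
  where "fh_le \<phi> \<psi> \<longleftrightarrow> (\<forall>x\<in>bounded_ops. norm (\<phi> x) \<le> norm (\<psi> x))"

text \<open>Since \<open>fh_le\<close> is only a preorder, minimality does not assert \<open>\<psi> = \<phi>\<close>.\<close>

definition fh_minimal ::
    "('g, 'b) monoid_scheme \<Rightarrow> ('g \<Rightarrow> ('h::complex_hilbert \<Rightarrow>\<^sub>L 'h)) \<Rightarrow> (('h \<Rightarrow>\<^sub>L 'h) \<Rightarrow> ('h \<Rightarrow>\<^sub>L 'h)) \<Rightarrow> bool"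
  where "fh_minimal \<Gamma> \<pi> \<phi> \<longleftrightarrow>
    \<phi> \<in> fh_maps \<Gamma> \<pi> \<and> (\<forall>\<psi>\<in>fh_maps \<Gamma> \<pi>. fh_le \<psi> \<phi> \<longrightarrow> fh_le \<phi> \<psi>)"

record ('g, 'a) gamma_algebra = "'a ring" +
  act :: "'g \<Rightarrow> 'a \<Rightarrow> 'a"

text \<open>
  The image of \<open>\<phi>\<close> with the Choi--Effros product; scalar multiplication, involution and norm
  are those of \<open>B(H)\<close>.
\<close>

definition choi_effros ::
    "('g, 'b) monoid_scheme \<Rightarrow> ('g \<Rightarrow> ('h::complex_hilbert \<Rightarrow>\<^sub>L 'h)) \<Rightarrow>
      (('h \<Rightarrow>\<^sub>L 'h) \<Rightarrow> ('h \<Rightarrow>\<^sub>L 'h)) \<Rightarrow> ('g, 'h \<Rightarrow>\<^sub>L 'h) gamma_algebra"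
  where "choi_effros \<Gamma> \<pi> \<phi> =
    \<lparr>carrier = \<phi> ` bounded_ops, mult = (\<lambda>a b. \<phi> (a o\<^sub>L b)), one = id_blinfun,
     zero = 0, add = (+), act = conj_action \<Gamma> \<pi>\<rparr>"

text \<open>
  The boundary is determined only up to isomorphism, so being a Furstenberg--Hamana boundary is
  a predicate, satisfied by the algebra obtained from any minimal \<open>\<phi>\<close>.
\<close>

definition is_fh_boundary ::
    "('g, 'b) monoid_scheme \<Rightarrow> ('g \<Rightarrow> ('h::complex_hilbert \<Rightarrow>\<^sub>L 'h)) \<Rightarrow>
      ('g, 'h \<Rightarrow>\<^sub>L 'h) gamma_algebra \<Rightarrow> bool"
  where "is_fh_boundary \<Gamma> \<pi> B \<longleftrightarrow> (\<exists>\<phi>. fh_minimal \<Gamma> \<pi> \<phi> \<and> B = choi_effros \<Gamma> \<pi> \<phi>)"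

definition acts_trivially :: "'g set \<Rightarrow> ('g, 'a) gamma_algebra \<Rightarrow> bool"
  where "acts_trivially \<Lambda> B \<longleftrightarrow> (\<forall>g\<in>\<Lambda>. \<forall>x\<in>carrier B. act B g x = x)"

end

theory Submission
  imports Defs
begin

text \<open>
  Write \<open>g \<cdot> x\<close> for \<open>\<pi>(g) x \<pi>(g\<^sup>-\<^sup>1)\<close>, and let \<open>\<phi>\<close> be the minimal \<open>\<Gamma>\<close>-map whose image is
  the boundary.  An operator commutes with \<open>\<pi>(\<Lambda>)\<close> iff it is fixed by the action of \<open>\<Lambda>\<close>
  (\<open>commutant_iff_fixed\<close>).  So if \<open>\<Lambda>\<close> acts trivially on the image of \<open>\<phi>\<close>, then \<open>\<phi>\<close> itself is a
  \<open>\<Gamma>\<close>-map into the commutant of \<open>\<pi>(\<Lambda>)\<close>.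

  Conversely, let \<open>\<psi>\<close> be a \<open>\<Gamma>\<close>-map into that commutant.  Unital completely positive maps are
  contractive, so \<open>\<psi> \<circ> \<phi> \<le> \<phi>\<close>, and by minimality \<open>\<parallel>\<phi>(y)\<parallel> \<le> \<parallel>\<psi>(\<phi>(y))\<parallel>\<close> for every \<open>y\<close>.
  For \<open>g \<in> \<Lambda>\<close> and \<open>y = g \<cdot> x - x\<close> the right-hand side is the norm of
  \<open>g \<cdot> \<psi>(\<phi>(x)) - \<psi>(\<phi>(x)) = 0\<close>, hence \<open>g \<cdot> \<phi>(x) - \<phi>(x) = \<phi>(y) = 0\<close>.

  Contractivity (\<open>unital_completely_positive_contractive\<close>) comes from applying the map to the
  positive \<open>2 \<times> 2\<close> matrix with diagonal entries \<open>\<parallel>T\<parallel>\<close> and off-diagonal entries \<open>T\<close> and its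
  adjoint; the adjoint is obtained from the Riesz representation theorem.
\<close>


section \<open>Riesz representation and adjoints\<close>

text \<open>
  The representing vector is the minimizer of \<open>\<parallel>x\<parallel>\<^sup>2 - 2 f x\<close>; a minimizing sequence is Cauchy
  by the parallelogram law.
\<close>

lemma riesz_representation:
  fixes f :: "'a::{real_inner, complete_space} \<Rightarrow> real"
  assumes "bounded_linear f"
  obtains a where "\<And>x. f x = inner a x"
proof -
  interpret f: bounded_linear f by fact
  define Q where "Q x = (norm x)\<^sup>2 - 2 * f x" for x
  obtain K where K: "\<And>x. norm (f x) \<le> norm x * K"
    using f.bounded by blast
  have "- K\<^sup>2 \<le> Q x" for x
  proof -
    have "0 \<le> (norm x - K)\<^sup>2" by simp
    then show ?thesis
      using K[of x] by (simp add: Q_def power2_diff abs_le_iff)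
  qed
  then have bdd: "bdd_below (range Q)" by (auto intro!: bdd_belowI)
  define m where "m = (INF x. Q x)"
  have m_le: "m \<le> Q x" for x
    unfolding m_def using bdd by (rule cINF_lower) simp
  have "\<exists>x. Q x < m + 1 / Suc n" for n
    using cINF_less_iff[OF _ bdd, of "m + 1 / Suc n"] by (auto simp: m_def)
  then obtain X where X: "\<And>n. Q (X n) < m + 1 / Suc n" by metis
  have dist_le: "(norm (a - b))\<^sup>2 \<le> 2 * (Q a - m) + 2 * (Q b - m)" for a b
  proof -
    have "(norm (a - b))\<^sup>2 = 2 * Q a + 2 * Q b - 4 * Q ((1/2) *\<^sub>R (a + b))"
      by (simp add: Q_def power2_norm_eq_inner f.add f.scaleR inner_commute algebra_simps
          inner_simps)
    then show ?thesis using m_le[of "(1/2) *\<^sub>R (a + b)"] by simp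
  qed
  have "Cauchy X"
  proof (rule metric_CauchyI)
    fix e :: real assume e: "0 < e"
    obtain N where N: "1 / Suc N < e\<^sup>2 / 4"
      using nat_approx_posE[of "e\<^sup>2 / 4"] e by (metis zero_less_divide_iff zero_less_numeral
          zero_less_power)
    have small: "Q (X n) - m < e\<^sup>2 / 4" if "n \<ge> N" for n
    proof -
      have "1 / real (Suc n) \<le> 1 / real (Suc N)" using that by (simp add: frac_le)
      with X[of n] N show ?thesis by linarith
    qed
    show "\<exists>M. \<forall>i\<ge>M. \<forall>j\<ge>M. dist (X i) (X j) < e"
    proof (intro exI allI impI)
      fix i j assume "N \<le> i" "N \<le> j"
      then have "(norm (X i - X j))\<^sup>2 < e\<^sup>2"
        using dist_le[of "X i" "X j"] small[of i] small[of j] by simp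
      then show "dist (X i) (X j) < e"
        using e by (simp add: dist_norm power_less_imp_less_base)
    qed
  qed
  then obtain a where a: "X \<longlonglongrightarrow> a"
    using Cauchy_convergent convergent_def by blast
  have "(\<lambda>n. Q (X n)) \<longlonglongrightarrow> Q a"
    unfolding Q_def by (intro tendsto_intros f.tendsto a)
  moreover have "(\<lambda>n. m + 1 / Suc n) \<longlonglongrightarrow> m + 0"
    using LIMSEQ_inverse_real_of_nat by (intro tendsto_intros) (simp add: inverse_eq_divide)
  ultimately have "Q a \<le> m + 0"
    using X by (intro LIMSEQ_le[where X = "\<lambda>n. Q (X n)"]) (auto intro: less_imp_le)
  then have Q_min: "Q a \<le> Q x" for x using m_le[of x] by simp
  have "f v = inner a v" for v
  proof (cases "v = 0")
    case False
    define d where "d = inner a v - f v"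
    \<comment> \<open>\<open>t\<close> minimizes the quadratic polynomial \<open>t \<mapsto> Q (a + t v)\<close>.\<close>
    define t where "t = - d / inner v v"
    have "Q (a + t *\<^sub>R v) = Q a + 2 * t * d + t\<^sup>2 * inner v v"
      unfolding Q_def power2_norm_eq_inner
      by (simp add: d_def f.add f.scaleR inner_commute algebra_simps inner_simps
          power2_eq_square)
    also have "\<dots> = Q a - d\<^sup>2 / inner v v"
      using False by (simp add: t_def field_simps power2_eq_square)
    finally have "d\<^sup>2 / inner v v \<le> 0" using Q_min[of "a + t *\<^sub>R v"] by simp
    then have "d = 0" using False by (simp add: pos_divide_le_eq)
    then show ?thesis by (simp add: d_def)
  qed (simp add: f.zero)
  then show ?thesis using that by blast
qed

lemma Im_cinner: "Im (cinner x y) = inner (- \<i> *\<^sub>C x) (y :: 'h::complex_hilbert)"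
  by (simp add: cinner_scaleC_left flip: Re_cinner)

lemma cinner_scaleC_right: "cinner x (c *\<^sub>C y) = cnj c * cinner x (y :: 'h::complex_hilbert)"
  by (metis cinner_scaleC_left cinner_commute complex_cnj_mult)

lemma inner_scaleC_left: "inner (c *\<^sub>C x) y = inner x (cnj c *\<^sub>C (y :: 'h::complex_hilbert))"
  by (simp add: cinner_scaleC_left cinner_scaleC_right flip: Re_cinner)

lemma cinner_self: "cinner x x = of_real ((norm (x :: 'h::complex_hilbert))\<^sup>2)"
proof -
  have "Im (cinner x x) = 0"
    using arg_cong[OF cinner_commute[of x x], of Im] by simp
  then show ?thesis by (simp add: complex_eq_iff Re_cinner power2_norm_eq_inner)
qed

lemma bounded_ops_adjoint:
  fixes T :: "'h::complex_hilbert \<Rightarrow>\<^sub>L 'h"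
  assumes T: "T \<in> bounded_ops"
  obtains T' where "T' \<in> bounded_ops"
    "\<And>x y. cinner (blinfun_apply T' x) y = cinner x (blinfun_apply T y)"
proof -
  have "\<exists>a. \<forall>y. inner x (blinfun_apply T y) = inner a y" for x
    using riesz_representation[of "\<lambda>y. inner x (blinfun_apply T y)"]
      bounded_linear_compose[OF bounded_linear_inner_right blinfun.bounded_linear_right] by metis
  then obtain A where A: "\<And>x y. inner x (blinfun_apply T y) = inner (A x) y" by metis
  have eqI: "u = v" if "\<And>y. inner u y = inner v y" for u v :: 'h
    using that[of "u - v"] by (metis inner_diff_left inner_eq_zero_iff right_minus_eq)
  have AC: "A (c *\<^sub>C x) = c *\<^sub>C A x" for c x
  proof (rule eqI)
    fix y
    have "inner (A (c *\<^sub>C x)) y = inner x (blinfun_apply T (cnj c *\<^sub>C y))"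
      using T by (simp add: inner_scaleC_left bounded_ops_def flip: A)
    then show "inner (A (c *\<^sub>C x)) y = inner (c *\<^sub>C A x) y"
      by (simp add: inner_scaleC_left A)
  qed
  have "bounded_linear A"
  proof (rule bounded_linear_intro[where K = "norm T"])
    show "A (x + y) = A x + A y" for x y
      by (rule eqI) (simp add: inner_add_left flip: A)
    show "A (r *\<^sub>R x) = r *\<^sub>R A x" for r x
      by (rule eqI) (simp flip: A)
    show "norm (A x) \<le> norm x * norm T" for x
    proof (cases "A x = 0")
      case False
      have "norm (A x) * norm (A x) = inner x (blinfun_apply T (A x))"
        by (simp add: A flip: power2_norm_eq_inner power2_eq_square)
      also have "\<dots> \<le> norm x * norm (blinfun_apply T (A x))" by (rule norm_cauchy_schwarz)
      also have "\<dots> \<le> norm x * (norm T * norm (A x))"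
        by (intro mult_left_mono norm_blinfun) auto
      finally show ?thesis using False by simp
    qed simp
  qed
  then have app: "blinfun_apply (Blinfun A) = A" by (rule bounded_linear_Blinfun_apply)
  show ?thesis
  proof
    show "Blinfun A \<in> bounded_ops" by (simp add: bounded_ops_def app AC)
    show "cinner (blinfun_apply (Blinfun A) x) y = cinner x (blinfun_apply T y)" for x y
      unfolding app complex_eq_iff Re_cinner Im_cinner
      by (simp add: A flip: AC)
  qed
qed


section \<open>Contractivity of unital completely positive maps\<close>

lemma blinfun_apply_scaleC_op: "blinfun_apply (scaleC_op c T) x = c *\<^sub>C blinfun_apply T x"
  by transfer simp

lemma scaleC_op_of_real: "scaleC_op (complex_of_real r) T = r *\<^sub>R T"
  by (rule blinfun_eqI) (simp add: blinfun_apply_scaleC_op scaleC_of_real blinfun.scaleR_left)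

lemma scaleC_commute: "c *\<^sub>C d *\<^sub>C x = d *\<^sub>C c *\<^sub>C (x :: 'h::complex_hilbert)"
  by (simp add: scaleC_scaleC mult.commute)

lemma id_in_bounded_ops: "id_blinfun \<in> bounded_ops"
  by (simp add: bounded_ops_def)

lemma scaleR_in_bounded_ops: "T \<in> bounded_ops \<Longrightarrow> r *\<^sub>R T \<in> bounded_ops"
  by (auto simp: bounded_ops_def scaleC_commute blinfun.scaleR_left simp flip: scaleC_of_real)

lemma diff_in_bounded_ops:
  assumes "S \<in> bounded_ops" "T \<in> bounded_ops"
  shows "S - T \<in> bounded_ops"
proof -
  have "c *\<^sub>C x - c *\<^sub>C y = c *\<^sub>C (x - y)" for c and x y :: 'a
    using scaleC_add_right[of c "x - y" y] by simp
  then show ?thesis using assms by (simp add: bounded_ops_def blinfun.diff_left)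
qed

lemma compose_in_bounded_ops:
  "S \<in> bounded_ops \<Longrightarrow> T \<in> bounded_ops \<Longrightarrow> S o\<^sub>L T \<in> bounded_ops"
  by (simp add: bounded_ops_def)

lemma unital_completely_positive_contractive:
  fixes \<psi> :: "('h::complex_hilbert \<Rightarrow>\<^sub>L 'h) \<Rightarrow> ('h \<Rightarrow>\<^sub>L 'h)"
  assumes maps: "\<psi> \<in> bounded_ops \<rightarrow> bounded_ops"
    and cp: "completely_positive_on bounded_ops \<psi>"
    and unital: "\<psi> id_blinfun = id_blinfun"
    and hom: "\<And>c x. x \<in> bounded_ops \<Longrightarrow> \<psi> (scaleC_op c x) = scaleC_op c (\<psi> x)"
    and T: "T \<in> bounded_ops"
  shows "norm (\<psi> T) \<le> norm T"
proof -
  obtain T' where T': "T' \<in> bounded_ops"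
    and adj: "\<And>x y. cinner (blinfun_apply T' x) y = cinner x (blinfun_apply T y)"
    using bounded_ops_adjoint[OF T] by blast
  define M where "M = norm T"
  define X :: "nat \<Rightarrow> nat \<Rightarrow> 'h \<Rightarrow>\<^sub>L 'h" where
    "X i j = (if i = j then M *\<^sub>R id_blinfun else if i = 0 then T else T')" for i j
  have X_ops: "X i j \<in> bounded_ops" for i j
    by (simp add: X_def T T' scaleR_in_bounded_ops id_in_bounded_ops)
  have "positive_matrix 2 X"
    unfolding positive_matrix_def
  proof
    fix \<xi> :: "nat \<Rightarrow> 'h"
    let ?a = "\<xi> 0" and ?b = "\<xi> 1"
    let ?z = "cinner (blinfun_apply T ?b) ?a"
    have "\<bar>inner (blinfun_apply T ?b) ?a\<bar> \<le> norm (blinfun_apply T ?b) * norm ?a"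
      by (rule Cauchy_Schwarz_ineq2)
    also have "\<dots> \<le> M * norm ?b * norm ?a"
      unfolding M_def by (intro mult_right_mono norm_blinfun) simp
    finally have le: "\<bar>Re ?z\<bar> \<le> M * (norm ?b * norm ?a)" by (simp add: Re_cinner)
    have "0 \<le> M * (norm ?a - norm ?b)\<^sup>2" by (simp add: M_def)
    with le have nonneg: "0 \<le> M * (norm ?a)\<^sup>2 + M * (norm ?b)\<^sup>2 + 2 * Re ?z"
      by (simp add: power2_diff algebra_simps)
    have "(\<Sum>i<2. cinner (\<Sum>j<2. blinfun_apply (X i j) (\<xi> j)) (\<xi> i)) =
        of_real (M * (norm ?a)\<^sup>2 + M * (norm ?b)\<^sup>2) + (?z + cnj ?z)"
      using cinner_commute[of ?a "blinfun_apply T ?b"]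
      by (simp add: numeral_2_eq_2 X_def blinfun.scaleR_left cinner_add_left adj cinner_self
          cinner_scaleC_left flip: scaleC_of_real)
    also have "\<dots> = of_real (M * (norm ?a)\<^sup>2 + M * (norm ?b)\<^sup>2 + 2 * Re ?z)"
      by (simp add: complex_add_cnj)
    finally show "(\<Sum>i<2. cinner (\<Sum>j<2. blinfun_apply (X i j) (\<xi> j)) (\<xi> i)) \<in> \<real>\<^sub>\<ge>\<^sub>0"
      using nonneg by (simp add: complex_nonneg_Reals_iff)
  qed
  then have pos: "positive_matrix 2 (\<lambda>i j. \<psi> (X i j))"
    using cp X_ops unfolding completely_positive_on_def by blast
  have diag: "\<psi> (M *\<^sub>R id_blinfun) = M *\<^sub>R id_blinfun"
    using hom[OF id_in_bounded_ops, of "of_real M"] by (simp add: unital scaleC_op_of_real)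
  define P where "P a b = of_real (M * (norm a)\<^sup>2 + M * (norm b)\<^sup>2) +
      (cinner (blinfun_apply (\<psi> T) b) a + cinner (blinfun_apply (\<psi> T') a) b)" for a b
  have P: "P a b \<in> \<real>\<^sub>\<ge>\<^sub>0" for a b
  proof -
    let ?\<xi> = "\<lambda>i::nat. if i = 0 then a else b"
    have "(\<Sum>i<2. cinner (\<Sum>j<2. blinfun_apply (\<psi> (X i j)) (?\<xi> j)) (?\<xi> i)) = P a b"
      by (simp add: P_def numeral_2_eq_2 X_def diag blinfun.scaleR_left cinner_add_left
          cinner_self cinner_scaleC_left flip: scaleC_of_real)
    then show ?thesis using pos[unfolded positive_matrix_def, rule_format, of ?\<xi>] by simp
  qed
  have key: "0 \<le> M * (norm a)\<^sup>2 + M * (norm b)\<^sup>2 + 2 * inner (blinfun_apply (\<psi> T) b) a" for a b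
  proof -
    \<comment> \<open>That the form is real at \<open>(\<i> a, b)\<close> makes its two off-diagonal terms at \<open>(a, b)\<close> have
      equal real parts.\<close>
    have "blinfun_apply (\<psi> T') (\<i> *\<^sub>C a) = \<i> *\<^sub>C blinfun_apply (\<psi> T') a"
      using maps T' by (auto simp: bounded_ops_def Pi_iff)
    then have "Re (cinner (blinfun_apply (\<psi> T) b) a) = Re (cinner (blinfun_apply (\<psi> T') a) b)"
      using P[of "\<i> *\<^sub>C a" b]
      by (simp add: complex_nonneg_Reals_iff P_def cinner_scaleC_left cinner_scaleC_right)
    then show ?thesis
      using P[of a b] by (simp add: complex_nonneg_Reals_iff P_def flip: Re_cinner)
  qed
  show ?thesis
  proof (rule norm_blinfun_bound)
    fix b
    let ?y = "blinfun_apply (\<psi> T) b"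
    show "norm ?y \<le> norm T * norm b"
    proof (cases "?y = 0 \<or> b = 0")
      case False
      define t where "t = norm b / norm ?y"
      \<comment> \<open>The vector \<open>- t ?y\<close> has the norm of \<open>b\<close> and points against \<open>?y\<close>.\<close>
      have "0 \<le> M * (norm (- t *\<^sub>R ?y))\<^sup>2 + M * (norm b)\<^sup>2 + 2 * inner ?y (- t *\<^sub>R ?y)"
        by (rule key)
      also have "\<dots> = 2 * norm b * (M * norm b - norm ?y)"
        using False by (simp add: t_def power2_eq_square algebra_simps
            dot_square_norm)
      finally show ?thesis using False by (simp add: M_def zero_le_mult_iff)
    qed (auto simp: blinfun.zero_right)
  qed simp
qed


section \<open>The conjugation action\<close>

lemma hom_unitary_one:
  fixes \<pi> :: "'g \<Rightarrow> ('h::complex_hilbert \<Rightarrow>\<^sub>L 'h)"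
  assumes "group \<Gamma>" and \<pi>: "\<pi> \<in> hom \<Gamma> unitary_group"
  shows "\<pi> \<one>\<^bsub>\<Gamma>\<^esub> = id_blinfun"
proof (rule blinfun_eqI)
  interpret group \<Gamma> by fact
  fix x
  let ?U = "\<pi> \<one>\<^bsub>\<Gamma>\<^esub>"
  have U: "?U \<in> carrier unitary_group" and "?U = ?U o\<^sub>L ?U"
    using \<pi> hom_mult[OF \<pi>, of "\<one>\<^bsub>\<Gamma>\<^esub>" "\<one>\<^bsub>\<Gamma>\<^esub>"] by (auto simp: hom_def unitary_group_def)
  then have idem: "blinfun_apply ?U (blinfun_apply ?U y) = blinfun_apply ?U y" for y
    by (metis blinfun_apply_blinfun_compose)
  obtain y where "x = blinfun_apply ?U y"
    using U unfolding unitary_group_def by (auto dest: surjD[where y = x])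
  then show "blinfun_apply ?U x = blinfun_apply id_blinfun x"
    by (simp add: idem)
qed

lemma hom_unitary_inverse:
  fixes \<pi> :: "'g \<Rightarrow> ('h::complex_hilbert \<Rightarrow>\<^sub>L 'h)"
  assumes "group \<Gamma>" and \<pi>: "\<pi> \<in> hom \<Gamma> unitary_group" and g: "g \<in> carrier \<Gamma>"
  shows "\<pi> g o\<^sub>L \<pi> (inv\<^bsub>\<Gamma>\<^esub> g) = id_blinfun" "\<pi> (inv\<^bsub>\<Gamma>\<^esub> g) o\<^sub>L \<pi> g = id_blinfun"
proof -
  interpret group \<Gamma> by fact
  show "\<pi> g o\<^sub>L \<pi> (inv\<^bsub>\<Gamma>\<^esub> g) = id_blinfun" "\<pi> (inv\<^bsub>\<Gamma>\<^esub> g) o\<^sub>L \<pi> g = id_blinfun"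
    using g hom_mult[OF \<pi>, of g "inv\<^bsub>\<Gamma>\<^esub> g"] hom_mult[OF \<pi>, of "inv\<^bsub>\<Gamma>\<^esub> g" g]
      hom_unitary_one[OF assms(1) \<pi>] by (simp_all add: unitary_group_def)
qed

lemma conj_action_in_bounded_ops:
  assumes "group \<Gamma>" and \<pi>: "\<pi> \<in> hom \<Gamma> unitary_group" and g: "g \<in> carrier \<Gamma>"
    and x: "x \<in> bounded_ops"
  shows "conj_action \<Gamma> \<pi> g x \<in> bounded_ops"
proof -
  have "\<pi> h \<in> bounded_ops" if "h \<in> carrier \<Gamma>" for h
    using \<pi> that by (auto simp: hom_def unitary_group_def)
  then show ?thesis
    using g x group.inv_closed[OF assms(1) g]
    by (simp add: conj_action_def compose_in_bounded_ops)
qed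

lemma commutant_iff_fixed:
  assumes G: "group \<Gamma>" and \<pi>: "\<pi> \<in> hom \<Gamma> unitary_group" and \<Lambda>: "\<Lambda> \<subseteq> carrier \<Gamma>"
  shows "T \<in> commutant (\<pi> ` \<Lambda>) \<longleftrightarrow>
    T \<in> bounded_ops \<and> (\<forall>g\<in>\<Lambda>. conj_action \<Gamma> \<pi> g T = T)"
proof -
  have "\<pi> g o\<^sub>L T = T o\<^sub>L \<pi> g \<longleftrightarrow> conj_action \<Gamma> \<pi> g T = T" if "g \<in> \<Lambda>" for g
  proof -
    have g: "g \<in> carrier \<Gamma>" using that \<Lambda> by blast
    note inverse = hom_unitary_inverse[OF G \<pi> g]
    have right: "(S o\<^sub>L \<pi> g) o\<^sub>L \<pi> (inv\<^bsub>\<Gamma>\<^esub> g) = S" "(S o\<^sub>L \<pi> (inv\<^bsub>\<Gamma>\<^esub> g)) o\<^sub>L \<pi> g = S" for S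
      using inverse[THEN arg_cong[where f = blinfun_apply]]
      by (auto intro!: blinfun_eqI simp: fun_eq_iff)
    show ?thesis unfolding conj_action_def by (metis right)
  qed
  then show ?thesis unfolding commutant_def by auto
qed


section \<open>Amenable normal subgroups and the boundary\<close>

lemma fh_maps_compose:
  assumes \<phi>: "\<phi> \<in> fh_maps \<Gamma> \<pi>" and \<psi>: "gamma_map \<Gamma> \<pi> bounded_ops S \<psi>"
    and S: "S \<subseteq> bounded_ops"
  shows "\<psi> \<circ> \<phi> \<in> fh_maps \<Gamma> \<pi>"
proof -
  have closed: "\<phi> x \<in> bounded_ops" if "x \<in> bounded_ops" for x
    using \<phi> that by (auto simp: fh_maps_def gamma_map_def)
  have "completely_positive_on bounded_ops (\<psi> \<circ> \<phi>)"
    using \<phi> \<psi> closed unfolding fh_maps_def gamma_map_def completely_positive_on_def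
    by simp
  then show ?thesis
    using \<phi> \<psi> S closed unfolding fh_maps_def gamma_map_def by (auto simp: Pi_iff)
qed

lemma gamma_map_contractive:
  assumes "gamma_map \<Gamma> \<pi> bounded_ops S \<psi>" "S \<subseteq> bounded_ops" "x \<in> bounded_ops"
  shows "norm (\<psi> x) \<le> norm x"
  using assms by (intro unital_completely_positive_contractive) (auto simp: gamma_map_def)

lemma gamma_map_diff:
  assumes \<psi>: "gamma_map \<Gamma> \<pi> bounded_ops S \<psi>" and x: "x \<in> bounded_ops" and y: "y \<in> bounded_ops"
  shows "\<psi> (x - y) = \<psi> x - \<psi> y"
proof -
  have "\<psi> ((x - y) + y) = \<psi> (x - y) + \<psi> y"
    using \<psi> diff_in_bounded_ops[OF x y] y unfolding gamma_map_def by blast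
  then show ?thesis by simp
qed

theorem theorem4p4:
  fixes \<Gamma> :: "('g, 'b) monoid_scheme"
    and \<pi> :: "'g \<Rightarrow> ('h::complex_hilbert \<Rightarrow>\<^sub>L 'h)"
    and \<Lambda> :: "'g set"
    and B :: "('g, 'h \<Rightarrow>\<^sub>L 'h) gamma_algebra"
  assumes "group \<Gamma>"
    and "\<pi> \<in> hom \<Gamma> unitary_group"
    and "\<Lambda> \<lhd> \<Gamma>"
    and "is_fh_boundary \<Gamma> \<pi> B"
  shows "pi_amenable \<Gamma> \<pi> \<Lambda> \<longleftrightarrow> acts_trivially \<Lambda> B"
proof -
  have \<Lambda>: "\<Lambda> \<subseteq> carrier \<Gamma>"
    using assms(3) by (simp add: normal_imp_subgroup subgroup.subset)
  note commutant_iff = commutant_iff_fixed[OF assms(1,2) \<Lambda>]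
  obtain \<phi> where min: "fh_minimal \<Gamma> \<pi> \<phi>" and B: "B = choi_effros \<Gamma> \<pi> \<phi>"
    using assms(4) by (auto simp: is_fh_boundary_def)
  then have \<phi>: "\<phi> \<in> fh_maps \<Gamma> \<pi>" by (simp add: fh_minimal_def)
  then have \<phi>_map: "gamma_map \<Gamma> \<pi> bounded_ops bounded_ops \<phi>" by (simp add: fh_maps_def)
  then have closed: "\<phi> x \<in> bounded_ops" if "x \<in> bounded_ops" for x
    using that by (auto simp: gamma_map_def)
  have trivial: "acts_trivially \<Lambda> B \<longleftrightarrow>
      (\<forall>g\<in>\<Lambda>. \<forall>x\<in>bounded_ops. conj_action \<Gamma> \<pi> g (\<phi> x) = \<phi> x)"
    by (simp add: acts_trivially_def B choi_effros_def)
  show ?thesis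
  proof
    assume "acts_trivially \<Lambda> B"
    then have "\<phi> \<in> bounded_ops \<rightarrow> commutant (\<pi> ` \<Lambda>)"
      using closed by (auto simp: trivial commutant_iff)
    then have "gamma_map \<Gamma> \<pi> bounded_ops (commutant (\<pi> ` \<Lambda>)) \<phi>"
      using \<phi>_map by (simp add: gamma_map_def)
    then show "pi_amenable \<Gamma> \<pi> \<Lambda>" by (auto simp: pi_amenable_def)
  next
    assume "pi_amenable \<Gamma> \<pi> \<Lambda>"
    then obtain \<psi> where \<psi>: "gamma_map \<Gamma> \<pi> bounded_ops (commutant (\<pi> ` \<Lambda>)) \<psi>"
      by (auto simp: pi_amenable_def)
    have sub: "commutant (\<pi> ` \<Lambda>) \<subseteq> bounded_ops" by (auto simp: commutant_def)
    have comp: "\<psi> \<circ> \<phi> \<in> fh_maps \<Gamma> \<pi>"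
      using \<phi> \<psi> sub by (rule fh_maps_compose)
    have "fh_le (\<psi> \<circ> \<phi>) \<phi>"
      using gamma_map_contractive[OF \<psi> sub] closed by (simp add: fh_le_def)
    with min comp have "fh_le \<phi> (\<psi> \<circ> \<phi>)" by (simp add: fh_minimal_def)
    then have le: "norm (\<phi> x) \<le> norm (\<psi> (\<phi> x))" if "x \<in> bounded_ops" for x
      using that by (simp add: fh_le_def)
    have "conj_action \<Gamma> \<pi> g (\<phi> x) = \<phi> x" if g: "g \<in> \<Lambda>" and x: "x \<in> bounded_ops" for g x
    proof -
      let ?gx = "conj_action \<Gamma> \<pi> g x"
      have g': "g \<in> carrier \<Gamma>" using g \<Lambda> by blast
      have gx: "?gx \<in> bounded_ops"
        using conj_action_in_bounded_ops[OF assms(1,2) g' x] .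
      have \<phi>_gx: "\<phi> ?gx = conj_action \<Gamma> \<pi> g (\<phi> x)"
        using \<phi>_map g' x by (simp add: gamma_map_def)
      have "\<psi> (\<phi> x) \<in> commutant (\<pi> ` \<Lambda>)"
        using \<psi> closed[OF x] by (auto simp: gamma_map_def)
      then have "\<psi> (\<phi> ?gx) = \<psi> (\<phi> x)"
        using \<psi> g g' closed[OF x] by (simp add: \<phi>_gx gamma_map_def commutant_iff)
      then have "\<psi> (\<phi> (?gx - x)) = 0"
        by (simp add: gamma_map_diff[OF \<phi>_map gx x]
            gamma_map_diff[OF \<psi> closed[OF gx] closed[OF x]])
      then have "\<phi> (?gx - x) = 0"
        using le[OF diff_in_bounded_ops[OF gx x]] by simp
      then show ?thesis by (simp add: gamma_map_diff[OF \<phi>_map gx x] \<phi>_gx)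
    qed
    then show "acts_trivially \<Lambda> B" by (simp add: trivial)
  qed
qed

end
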